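(* For periodic or compactly supported boundary conditions, the fully discrete local discontinuous Galerkin (LDG) scheme (S) described in the context is unconditionally stable, and the numerical solution $u_h^n$ satisfies $$\|u_h^n\|\le \|u_h^0\|,\qquad n=1,2,\dots,M.$$
   Context: **Continuous problem.** Let $\Omega=(a,b)$ and $T>0$. The tempered fractional reaction-diffusion equation is $${}_0^{C}D_t^{\alpha,\gamma}u(x,t)+\rho u(x,t)-\frac{\partial^2 u(x,t)}{\partial x^2}=f(x,t),\quad (x,t)\in(a,b)\times(0,T],\qquad u(x,0)=u_0(x),$$ where $f$ and $u_0$ are given smooth functions, $\rho>0$ is the constant reaction rate, and $${}_0^{C}D_t^{\alpha,\gamma}u(x,t)=\frac{e^{-\gamma t}}{\Gamma(1-\alpha)}\int_0^t\frac{\partial}{\partial s}\left[e^{\gamma s}u(x,s)\right]\frac{ds}{(t-s)^\alpha}$$ is the tempered fractional derivative of order $0<\alpha<1$ with tempering parameter $\gamma$; $\Gamma(\cdot)$ is the Gamma function. The equation is rewritten as the first-order system $p=u_x$, ${}_0^{C}D_t^{\alpha,\gamma}u+\rho u-p_x=f$. **Standing convention of the numerical analysis.** To simplify notation, and as what is described as no loss of generality, the numerical analysis takes $f=0$. **Time grid.** $M$ is a positive integer, $\tau=T/M$, $t_n=n\tau$ for $n=0,1,\dots,M$, $b_i=(i+1)^{1-\alpha}-i^{1-\alpha}$, and $f^n=f(\cdot,t_n)$. **Space grid.** $a=x_{1/2}<x_{3/2}<\cdots<x_{N+1/2}=b$ with $N$ an integer, $I_j=[x_{j-1/2},x_{j+1/2}]$,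 $h_j=x_{j+1/2}-x_{j-1/2}$ for $j=1,\dots,N$, $h=\max_{1\le j\le N}h_j$. The mesh is quasi-uniform: there is a constant $\kappa>0$ independent of $h$ such that $h_j\ge\kappa h$. **Finite element space.** $V_h^k=\{v: v|_{I_j}\in P^k(I_j),\ j=1,\dots,N\}$, where $P^k(I_j)$ denotes the polynomials of degree at most $k$ on $I_j$. Derivatives $v_x$ are taken cell by cell. At a cell interface $x_{j+1/2}$, $v^+_{j+1/2}$ and $v^-_{j+1/2}$ denote the values from the right cell $I_{j+1}$ and the left cell $I_j$, and for a weight $\delta$ the weighted average is $$v^{(\delta)}_{j+1/2}=\delta v^+_{j+1/2}+(1-\delta)v^-_{j+1/2}.$$ The norm $\|\cdot\|$ is the $L^2(\Omega)$ norm. **Scheme (S).** With $u_h^0\in V_h^k$ the numerical initial solution, the numerical solutions $u_h^n,p_h^n\in V_h^k$ satisfy, for all test functions $v,w\in V_h^k$, $$\left(\rho+\frac{\tau^{-\alpha}}{\Gamma(2-\alpha)}\right)\int_\Omega u_h^n v\,dx+\int_\Omega p_h^n v_x\,dx-\sum_{j=1}^N\left((\widehat{p_h^n}v^-)_{j+\frac12}-(\widehat{p_h^n}v^+)_{j-\frac12}\right)$$ $$=\frac{\tau^{-\alpha}}{\Gamma(2-\alpha)}\left(\sum_{i=1}^{n-1}(b_{i-1}-b_i)e^{-i\gamma\tau}\int_\Omega u_h^{n-i}v\,dx+b_{n-1}e^{-n\gamma\tau}\int_\Omega u_h^0 v\,dx\right)+\int_\Omega f^n v\,dx,$$ $$\int_\Omega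 p_h^n w\,dx+\int_\Omega u_h^n w_x\,dx-\sum_{j=1}^N\left((\widehat{u_h^n}w^-)_{j+\frac12}-(\widehat{u_h^n}w^+)_{j-\frac12}\right)=0,$$ with the generalized alternating numerical fluxes $$\widehat{u_h^n}=(u_h^n)^{(\delta)},\qquad \widehat{p_h^n}=(p_h^n)^{(1-\delta)},$$ for a given parameter $\delta\neq\frac12$.
   Formalization: The tempering parameter γ is assumed nonnegative, which the text does not state; for sufficiently negative γ the bound fails (one periodic cell, k=0, n=1 gives u^1 = βe^{-γτ}u^0/(ρ+β), where β = τ^{-α}/Γ(2-α)). *)

theory Defs
  imports "HOL-Analysis.Analysis" "HOL-Computational_Algebra.Polynomial"
begin

text \<open>A mesh is given by its nodes: \<open>x j\<close> is the interface $x_{j+1/2}$ for \<open>j \<le> N\<close>, so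
  the interior of the \<open>j\<close>-th cell $I_j$, \<open>1 \<le> j \<le> N\<close>, is the interval from \<open>x (j - 1)\<close> to
  \<open>x j\<close>.\<close>

definition is_mesh :: "real \<Rightarrow> real \<Rightarrow> nat \<Rightarrow> (nat \<Rightarrow> real) \<Rightarrow> bool" where
  "is_mesh a b N x \<longleftrightarrow> x 0 = a \<and> x N = b \<and> (\<forall>j\<in>{1..N}. x (j - 1) < x j)"

definition cell_size :: "(nat \<Rightarrow> real) \<Rightarrow> nat \<Rightarrow> real" where
  "cell_size x j = x j - x (j - 1)"

definition mesh_size :: "nat \<Rightarrow> (nat \<Rightarrow> real) \<Rightarrow> real" where
  "mesh_size N x = Max (cell_size x ` {1..N})"

definition quasi_uniform :: "real \<Rightarrow> nat \<Rightarrow> (nat \<Rightarrow> real) \<Rightarrow> bool" where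
  "quasi_uniform \<kappa> N x \<longleftrightarrow> (\<forall>j\<in>{1..N}. cell_size x j \<ge> \<kappa> * mesh_size N x)"

text \<open>The space $V_h^k$. Only the restriction to the open cells matters: elements may jump at the
  nodes, and values at the nodes or outside the domain enter neither the integrals nor the
  one-sided traces below.\<close>

definition dg_space :: "nat \<Rightarrow> nat \<Rightarrow> (nat \<Rightarrow> real) \<Rightarrow> (real \<Rightarrow> real) set" where
  "dg_space k N x =
     {v. \<forall>j\<in>{1..N}. \<exists>q::real poly. degree q \<le> k \<and> (\<forall>y\<in>{x (j - 1)<..<x j}. v y = poly q y)}"

definition L2_norm :: "real \<Rightarrow> real \<Rightarrow> (real \<Rightarrow> real) \<Rightarrow> real" where
  "L2_norm a b v = sqrt (integral {a..b} (\<lambda>y. (v y)\<^sup>2))"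

text \<open>The boundary condition supplies the traces from outside the domain: by periodicity, or, for
  compactly supported functions, from the extension by zero.\<close>

datatype boundary_condition = Periodic | Compactly_Supported

definition trace_minus ::
  "boundary_condition \<Rightarrow> nat \<Rightarrow> (nat \<Rightarrow> real) \<Rightarrow> (real \<Rightarrow> real) \<Rightarrow> nat \<Rightarrow> real" where
  "trace_minus bc N x v j =
     (if j = 0
      then (case bc of Periodic \<Rightarrow> Lim (at_left (x N)) v | Compactly_Supported \<Rightarrow> 0)
      else Lim (at_left (x j)) v)"

definition trace_plus ::
  "boundary_condition \<Rightarrow> nat \<Rightarrow> (nat \<Rightarrow> real) \<Rightarrow> (real \<Rightarrow> real) \<Rightarrow> nat \<Rightarrow> real" where
  "trace_plus bc N x v j =
     (if j = N
      then (case bc of Periodic \<Rightarrow> Lim (at_right (x 0)) v | Compactly_Supported \<Rightarrow> 0)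
      else Lim (at_right (x j)) v)"

definition weighted_average ::
  "boundary_condition \<Rightarrow> nat \<Rightarrow> (nat \<Rightarrow> real) \<Rightarrow> real \<Rightarrow> (real \<Rightarrow> real) \<Rightarrow> nat \<Rightarrow> real" where
  "weighted_average bc N x \<delta> v j =
     \<delta> * trace_plus bc N x v j + (1 - \<delta>) * trace_minus bc N x v j"

text \<open>The cellwise boundary terms, for a numerical flux \<open>F\<close> indexed by the nodes. The traces of
  the test function \<open>v\<close> are all taken from inside the domain, so here \<open>bc\<close> has no effect on
  them.\<close>

definition flux_sum ::
  "boundary_condition \<Rightarrow> nat \<Rightarrow> (nat \<Rightarrow> real) \<Rightarrow> (nat \<Rightarrow> real) \<Rightarrow> (real \<Rightarrow> real) \<Rightarrow> real" where
  "flux_sum bc N x F v =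
     (\<Sum>j=1..N. F j * trace_minus bc N x v j - F (j - 1) * trace_plus bc N x v (j - 1))"

definition time_weight :: "real \<Rightarrow> nat \<Rightarrow> real" where
  "time_weight \<alpha> i = real (i + 1) powr (1 - \<alpha>) - real i powr (1 - \<alpha>)"

text \<open>\<open>deriv v\<close> is the cellwise derivative, except at the finitely many nodes.\<close>

definition ldg_solution ::
  "boundary_condition \<Rightarrow> real \<Rightarrow> real \<Rightarrow> real \<Rightarrow> (real \<Rightarrow> real \<Rightarrow> real) \<Rightarrow> real \<Rightarrow> nat \<Rightarrow>
   real \<Rightarrow> real \<Rightarrow> nat \<Rightarrow> (nat \<Rightarrow> real) \<Rightarrow> nat \<Rightarrow> real \<Rightarrow>
   (nat \<Rightarrow> real \<Rightarrow> real) \<Rightarrow> (nat \<Rightarrow> real \<Rightarrow> real) \<Rightarrow> bool" where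
  "ldg_solution bc \<alpha> \<gamma> \<rho> f T M a b N x k \<delta> u p \<longleftrightarrow>
    (let \<tau> = T / real M;
         \<beta> = \<tau> powr (- \<alpha>) / Gamma (2 - \<alpha>);
         V = dg_space k N x
     in u 0 \<in> V \<and>
        (\<forall>n\<in>{1..M}. u n \<in> V \<and> p n \<in> V \<and>
          (\<forall>v\<in>V.
            (\<rho> + \<beta>) * integral {a..b} (\<lambda>y. u n y * v y)
              + integral {a..b} (\<lambda>y. p n y * deriv v y)
              - flux_sum bc N x (weighted_average bc N x (1 - \<delta>) (p n)) v
            = \<beta> * ((\<Sum>i=1..n - 1. (time_weight \<alpha> (i - 1) - time_weight \<alpha> i)
                        * exp (- real i * \<gamma> * \<tau>) * integral {a..b} (\<lambda>y. u (n - i) y * v y))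
                   + time_weight \<alpha> (n - 1) * exp (- real n * \<gamma> * \<tau>)
                        * integral {a..b} (\<lambda>y. u 0 y * v y))
              + integral {a..b} (\<lambda>y. f y (real n * \<tau>) * v y)) \<and>
          (\<forall>w\<in>V.
            integral {a..b} (\<lambda>y. p n y * w y)
              + integral {a..b} (\<lambda>y. u n y * deriv w y)
              - flux_sum bc N x (weighted_average bc N x \<delta> (u n)) w = 0)))"

text \<open>Stability of the scheme for \<open>f = 0\<close>, with a constant that depends neither on the time step
  nor on the mesh, and without any restriction relating the two.\<close>

definition unconditionally_stable ::
  "boundary_condition \<Rightarrow> real \<Rightarrow> real \<Rightarrow> real \<Rightarrow> real \<Rightarrow> real \<Rightarrow> real \<Rightarrow> real \<Rightarrow> nat \<Rightarrow> real \<Rightarrow> bool"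
  where
  "unconditionally_stable bc \<alpha> \<gamma> \<rho> T a b \<kappa> k \<delta> \<longleftrightarrow>
    (\<exists>C>0. \<forall>M N x u p.
       M > 0 \<longrightarrow> is_mesh a b N x \<longrightarrow> quasi_uniform \<kappa> N x \<longrightarrow>
       ldg_solution bc \<alpha> \<gamma> \<rho> (\<lambda>_ _. 0) T M a b N x k \<delta> u p \<longrightarrow>
       (\<forall>n\<in>{1..M}. L2_norm a b (u n) \<le> C * L2_norm a b (u 0)))"

end

theory Submission
  imports Defs
begin

text \<open>Testing the two equations with \<open>v = u n\<close> and \<open>w = p n\<close> and adding them, all spatial terms
  except the squared norm of \<open>p n\<close> cancel: the opposite weights of the two fluxes make the node
  contributions telescope, and both boundary conditions give equal contributions at the two end
  points. What remains is an inequality for the norms at the different time levels whose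
  coefficients are nonnegative, because the time weights decrease, and sum up to at most \<open>1\<close>.
  Young's inequality for the inner products and strong induction on the time level conclude.\<close>

text \<open>Serves two telescopings: that of the node contributions to the fluxes and, with reversed
  sign, that of the time weights.\<close>

lemma sum_diff_pred:
  fixes E :: "nat \<Rightarrow> 'a::ab_group_add"
  shows "(\<Sum>j=1..N. E j - E (j - 1)) = E N - E 0"
  by (induction N) auto

section \<open>Cellwise polynomials\<close>

lemma mesh_mono:
  fixes x :: "nat \<Rightarrow> 'a::order"
  assumes "\<forall>j\<in>{1..N}. x (j - 1) < x j"
  shows "x 0 \<le> x N"
  using assms
proof (induction N)
  case (Suc N)
  then have "x 0 \<le> x N" by simp
  moreover have "x N < x (Suc N)" using Suc.prems by (auto dest: bspec[of _ _ "Suc N"])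
  ultimately show ?case by simp
qed simp

lemma has_integral_cells:
  fixes g :: "real \<Rightarrow> 'a::banach" and x :: "nat \<Rightarrow> real"
  assumes "\<forall>j\<in>{1..N}. x (j - 1) < x j"
    and "\<And>j. j \<in> {1..N} \<Longrightarrow> (g has_integral I j) {x (j - 1)..x j}"
  shows "(g has_integral (\<Sum>j=1..N. I j)) {x 0..x N}"
  using assms
proof (induction N)
  case 0
  then show ?case by (simp add: has_integral_refl)
next
  case (Suc N)
  have "(g has_integral (\<Sum>j=1..N. I j)) {x 0..x N}"
    using Suc by simp
  moreover have "(g has_integral I (Suc N)) {x N..x (Suc N)}"
    using Suc.prems(2)[of "Suc N"] by simp
  moreover have "x 0 \<le> x N" "x N \<le> x (Suc N)"
    using Suc.prems(1) mesh_mono[of N x] by (auto dest: bspec[of _ _ "Suc N"] intro: less_imp_le)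
  ultimately show ?case
    by (simp add: has_integral_combine)
qed

text \<open>Agreement is asked for on the open interval only, since elements of
  \<open>dg_space\<close> are arbitrary at the nodes; the two end points are negligible for the
  integral.\<close>

lemma has_integral_eq_poly:
  fixes c d :: real
  assumes "c \<le> d" and "\<And>y. y \<in> {c<..<d} \<Longrightarrow> g y = poly (pderiv q) y"
  shows "(g has_integral (poly q d - poly q c)) {c..d}"
proof -
  have "(poly (pderiv q) has_integral (poly q d - poly q c)) {c..d}"
    using assms(1)
    by (intro fundamental_theorem_of_calculus)
      (auto simp flip: has_real_derivative_iff_has_vector_derivative
        intro: has_field_derivative_at_within poly_DERIV)
  then show ?thesis
    by (rule has_integral_spike_finite[of "{c, d}", rotated 2]) (use assms(2) in auto)
qed

lemma dg_space_polys:
  assumes "v \<in> dg_space k N x"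
  obtains q where "\<And>j y. j \<in> {1..N} \<Longrightarrow> y \<in> {x (j - 1)<..<x j} \<Longrightarrow> v y = poly (q j) y"
  using assms unfolding dg_space_def by (auto dest!: bchoice)

lemma deriv_eq_poly_pderiv:
  fixes y :: real
  assumes "\<And>y. y \<in> {c<..<d} \<Longrightarrow> v y = poly q y" and "y \<in> {c<..<d}"
  shows "deriv v y = poly (pderiv q) y"
proof (rule DERIV_imp_deriv)
  show "(v has_field_derivative poly (pderiv q) y) (at y)"
    by (rule has_field_derivative_transform_within_open[OF poly_DERIV[of q y], of "{c<..<d}"])
      (use assms in auto)
qed

section \<open>One-sided traces as values of the cell polynomials\<close>

lemma Lim_at_left_eq_poly:
  fixes c d :: real
  assumes "c < d" and "\<And>y. y \<in> {c<..<d} \<Longrightarrow> v y = poly q y"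
  shows "Lim (at_left d) v = poly q d"
proof (rule tendsto_Lim)
  have "(poly q \<longlongrightarrow> poly q d) (at_left d)"
    by (intro tendsto_intros)
  moreover have "\<forall>\<^sub>F y in at_left d. poly q y = v y"
    using eventually_at_left_real[OF assms(1)] by eventually_elim (simp add: assms(2))
  ultimately show "(v \<longlongrightarrow> poly q d) (at_left d)"
    by (rule Lim_transform_eventually)
qed simp

lemma Lim_at_right_eq_poly:
  fixes c d :: real
  assumes "c < d" and "\<And>y. y \<in> {c<..<d} \<Longrightarrow> v y = poly q y"
  shows "Lim (at_right c) v = poly q c"
proof (rule tendsto_Lim)
  have "(poly q \<longlongrightarrow> poly q c) (at_right c)"
    by (intro tendsto_intros)
  moreover have "\<forall>\<^sub>F y in at_right c. poly q y = v y"
    using eventually_at_right_real[OF assms(1)] by eventually_elim (simp add: assms(2))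
  ultimately show "(v \<longlongrightarrow> poly q c) (at_right c)"
    by (rule Lim_transform_eventually)
qed simp

section \<open>Integration over the mesh and cancellation of the fluxes\<close>

lemma integrable_cellwise_poly:
  fixes x :: "nat \<Rightarrow> real"
  assumes mesh: "\<forall>j\<in>{1..N}. x (j - 1) < x j"
    and "\<And>j y. j \<in> {1..N} \<Longrightarrow> y \<in> {x (j - 1)<..<x j} \<Longrightarrow> g y = poly (q j) y"
  shows "g integrable_on {x 0..x N}"
proof -
  have "g integrable_on {x (j - 1)..x j}" if "j \<in> {1..N}" for j
  proof (rule integrable_spike_finite[of "{x (j - 1), x j}"])
    show "poly (q j) integrable_on {x (j - 1)..x j}"
      by (intro integrable_continuous_real continuous_intros)
  qed (use assms(2)[OF that] in auto)
  then show ?thesis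
    using has_integral_cells[OF mesh, of g "\<lambda>j. integral {x (j - 1)..x j} g"]
    by blast
qed

lemma integrable_dg_mult:
  assumes "is_mesh a b N x" and "u \<in> dg_space k N x" and "v \<in> dg_space l N x"
  shows "(\<lambda>y. u y * v y) integrable_on {a..b}"
proof -
  obtain q where "\<And>j y. j \<in> {1..N} \<Longrightarrow> y \<in> {x (j - 1)<..<x j} \<Longrightarrow> u y = poly (q j) y"
    using dg_space_polys[OF assms(2)] by metis
  moreover obtain r where "\<And>j y. j \<in> {1..N} \<Longrightarrow> y \<in> {x (j - 1)<..<x j} \<Longrightarrow> v y = poly (r j) y"
    using dg_space_polys[OF assms(3)] by metis
  ultimately have "(\<lambda>y. u y * v y) integrable_on {x 0..x N}"
    using assms(1) unfolding is_mesh_def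
    by (intro integrable_cellwise_poly[where q = "\<lambda>j. q j * r j"]) auto
  then show ?thesis using assms(1) by (simp add: is_mesh_def)
qed

lemma integrable_dg_mult_deriv:
  assumes "is_mesh a b N x" and "u \<in> dg_space k N x" and "v \<in> dg_space l N x"
  shows "(\<lambda>y. u y * deriv v y) integrable_on {a..b}"
proof -
  obtain q where "\<And>j y. j \<in> {1..N} \<Longrightarrow> y \<in> {x (j - 1)<..<x j} \<Longrightarrow> u y = poly (q j) y"
    using dg_space_polys[OF assms(2)] by metis
  moreover obtain r where r: "\<And>j y. j \<in> {1..N} \<Longrightarrow> y \<in> {x (j - 1)<..<x j} \<Longrightarrow> v y = poly (r j) y"
    using dg_space_polys[OF assms(3)] by metis
  moreover have "deriv v y = poly (pderiv (r j)) y"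
    if "j \<in> {1..N}" "y \<in> {x (j - 1)<..<x j}" for j y
    using deriv_eq_poly_pderiv[OF r[OF that(1)] that(2)] .
  ultimately have "(\<lambda>y. u y * deriv v y) integrable_on {x 0..x N}"
    using assms(1) unfolding is_mesh_def
    by (intro integrable_cellwise_poly[where q = "\<lambda>j. q j * pderiv (r j)"]) auto
  then show ?thesis using assms(1) by (simp add: is_mesh_def)
qed

text \<open>On each cell the combined integrand is the derivative of the product of the two cell
  polynomials, so the fundamental theorem of calculus applies cell by cell. Only traces from inside
  the cells occur, hence \<open>bc\<close> is arbitrary.\<close>

lemma dg_integration_by_parts:
  assumes mesh: "is_mesh a b N x" and u: "u \<in> dg_space k N x" and p: "p \<in> dg_space l N x"
  shows "integral {a..b} (\<lambda>y. p y * deriv u y) + integral {a..b} (\<lambda>y. u y * deriv p y)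
    = (\<Sum>j=1..N. trace_minus bc N x p j * trace_minus bc N x u j
        - trace_plus bc N x p (j - 1) * trace_plus bc N x u (j - 1))"
proof -
  have less: "\<forall>j\<in>{1..N}. x (j - 1) < x j" and ab: "x 0 = a" "x N = b"
    using mesh by (auto simp: is_mesh_def)
  obtain q where q: "\<And>j y. j \<in> {1..N} \<Longrightarrow> y \<in> {x (j - 1)<..<x j} \<Longrightarrow> u y = poly (q j) y"
    using dg_space_polys[OF u] by metis
  obtain r where r: "\<And>j y. j \<in> {1..N} \<Longrightarrow> y \<in> {x (j - 1)<..<x j} \<Longrightarrow> p y = poly (r j) y"
    using dg_space_polys[OF p] by metis
  have cell: "((\<lambda>y. p y * deriv u y + u y * deriv p y) has_integral
      (trace_minus bc N x p j * trace_minus bc N x u j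
        - trace_plus bc N x p (j - 1) * trace_plus bc N x u (j - 1))) {x (j - 1)..x j}"
    if j: "j \<in> {1..N}" for j
  proof -
    have lt: "x (j - 1) < x j" using less j by blast
    \<comment> \<open>This keeps both traces out of the boundary branches of their definitions: they
      are one-sided limits taken from within cell \<open>j\<close>.\<close>
    have "j \<noteq> 0" "j - 1 \<noteq> N" using j by auto
    then have "trace_minus bc N x u j = poly (q j) (x j)"
      "trace_minus bc N x p j = poly (r j) (x j)"
      "trace_plus bc N x u (j - 1) = poly (q j) (x (j - 1))"
      "trace_plus bc N x p (j - 1) = poly (r j) (x (j - 1))"
      using q[OF j] r[OF j]
      by (auto simp: trace_minus_def trace_plus_def
          intro: Lim_at_left_eq_poly[OF lt] Lim_at_right_eq_poly[OF lt] simp del: One_nat_def)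
    moreover have "((\<lambda>y. p y * deriv u y + u y * deriv p y) has_integral
        (poly (r j * q j) (x j) - poly (r j * q j) (x (j - 1)))) {x (j - 1)..x j}"
    proof (rule has_integral_eq_poly)
      fix y assume y: "y \<in> {x (j - 1)<..<x j}"
      show "p y * deriv u y + u y * deriv p y = poly (pderiv (r j * q j)) y"
        using q[OF j y] r[OF j y] deriv_eq_poly_pderiv[OF q[OF j] y]
          deriv_eq_poly_pderiv[OF r[OF j] y]
        by (simp add: pderiv_mult)
    qed (use lt in simp)
    ultimately show ?thesis by simp
  qed
  show ?thesis
    using integral_unique[OF has_integral_cells[OF less cell]]
    by (simp add: ab integral_add[OF integrable_dg_mult_deriv[OF mesh p u]
          integrable_dg_mult_deriv[OF mesh u p]])
qed

text \<open>The weights \<delta> and \<open>1 - \<delta>\<close> of the two fluxes add up to 1, so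
  products of traces from the same side of a node cancel against the boundary terms of integration
  by parts. The mixed products that remain telescope over the cells.\<close>

lemma flux_terms_cancel:
  assumes mesh: "is_mesh a b N x" and "N > 0"
    and u: "u \<in> dg_space k N x" and p: "p \<in> dg_space l N x"
  shows "integral {a..b} (\<lambda>y. p y * deriv u y) + integral {a..b} (\<lambda>y. u y * deriv p y)
    = flux_sum bc N x (weighted_average bc N x (1 - \<delta>) p) u
      + flux_sum bc N x (weighted_average bc N x \<delta> u) p"
proof -
  define um up pm pp where defs: "um = trace_minus bc N x u" "up = trace_plus bc N x u"
    "pm = trace_minus bc N x p" "pp = trace_plus bc N x p"
  \<comment> \<open>What remains at node \<open>j\<close> when it is the right end of a cell; as the
    left end of the next cell it contributes \<open>- E j\<close>.\<close>
  define E where "E j = - (1 - \<delta>) * (pp j * um j) - \<delta> * (up j * pm j)" for j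
  \<comment> \<open>Periodicity identifies the traces at the two end points; extension by zero
    annihilates one factor of every mixed product there.\<close>
  have "E N = E 0"
  proof (cases bc)
    case Periodic
    then have "um 0 = um N" "pm 0 = pm N" "up N = up 0" "pp N = pp 0"
      using \<open>N > 0\<close> by (auto simp: defs trace_minus_def trace_plus_def)
    then show ?thesis by (simp add: E_def)
  next
    case Compactly_Supported
    then have "um 0 = 0" "pm 0 = 0" "up N = 0" "pp N = 0"
      by (auto simp: defs trace_minus_def trace_plus_def)
    then show ?thesis by (simp add: E_def)
  qed
  have "integral {a..b} (\<lambda>y. p y * deriv u y) + integral {a..b} (\<lambda>y. u y * deriv p y)
    - flux_sum bc N x (weighted_average bc N x (1 - \<delta>) p) u
    - flux_sum bc N x (weighted_average bc N x \<delta> u) p = (\<Sum>j=1..N. E j - E (j - 1))"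
    unfolding dg_integration_by_parts[OF mesh u p, of bc] flux_sum_def weighted_average_def
      defs[symmetric] sum_subtractf[symmetric]
    by (rule sum.cong) (auto simp: E_def algebra_simps)
  also have "\<dots> = 0"
    using \<open>E N = E 0\<close> by (simp only: sum_diff_pred diff_self)
  finally show ?thesis by simp
qed

section \<open>The time weights\<close>

lemma time_weight_0: "time_weight \<alpha> 0 = 1"
  by (simp add: time_weight_def)

lemma time_weight_nonneg: "\<alpha> \<le> 1 \<Longrightarrow> 0 \<le> time_weight \<alpha> i"
  by (simp add: time_weight_def powr_mono2)

text \<open>The mean value theorem for the power \<open>1 - \<alpha>\<close> on
  \<open>[i, i + 1]\<close>. It needs the derivative only in the open interval, so
  \<open>i = 0\<close> is covered: the positive exponent gives continuity at 0.\<close>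

lemma time_weight_eq_powr_between:
  assumes "\<alpha> < 1"
  obtains z where "real i < z" "z < real i + 1" "time_weight \<alpha> i = (1 - \<alpha>) * z powr - \<alpha>"
proof -
  have "((\<lambda>x. x powr (1 - \<alpha>)) has_real_derivative (1 - \<alpha>) * x powr - \<alpha>) (at x)"
    if "real i < x" for x
    using has_real_derivative_powr[of x "1 - \<alpha>"] that by simp
  moreover have "continuous_on {real i..real i + 1} (\<lambda>x. x powr (1 - \<alpha>))"
    using assms by (intro continuous_on_powr' continuous_intros) auto
  ultimately obtain z where "real i < z" "z < real i + 1"
    "(real i + 1) powr (1 - \<alpha>) - real i powr (1 - \<alpha>) = (1 - \<alpha>) * z powr - \<alpha> * (real i + 1 - real i)"
    using mvt[of "real i" "real i + 1" "\<lambda>x. x powr (1 - \<alpha>)" "\<lambda>x h. (1 - \<alpha>) * x powr - \<alpha> * h"]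
    unfolding has_field_derivative_def by (metis less_add_one)
  then show ?thesis
    by (intro that[of z]) (simp_all add: time_weight_def add.commute)
qed

text \<open>The intermediate points of consecutive intervals are ordered, and the power
  \<open>- \<alpha>\<close> is decreasing on the positive reals.\<close>

lemma time_weight_antimono:
  assumes "0 < \<alpha>" "\<alpha> < 1"
  shows "time_weight \<alpha> (Suc i) \<le> time_weight \<alpha> i"
proof -
  obtain y where y: "real i < y" "y < real i + 1" "time_weight \<alpha> i = (1 - \<alpha>) * y powr - \<alpha>"
    using time_weight_eq_powr_between[OF assms(2)] .
  obtain z where z: "real (Suc i) < z" "time_weight \<alpha> (Suc i) = (1 - \<alpha>) * z powr - \<alpha>"
    using time_weight_eq_powr_between[OF assms(2)] .
  have "0 < y" "y \<le> z"
    using y z by auto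
  then have "z powr - \<alpha> \<le> y powr - \<alpha>"
    using assms by (intro powr_mono2') auto
  then show ?thesis
    using assms y z by (simp add: mult_left_mono)
qed

section \<open>Stability\<close>

text \<open>Young's inequality, integrated. It bounds inner products directly by the squared norms
  on which the induction runs.\<close>

lemma integral_dg_mult_le:
  assumes "is_mesh a b N x" and "u \<in> dg_space k N x" and "v \<in> dg_space l N x"
  shows "integral {a..b} (\<lambda>y. u y * v y)
    \<le> (integral {a..b} (\<lambda>y. u y * u y) + integral {a..b} (\<lambda>y. v y * v y)) / 2"
proof -
  note int = integrable_dg_mult[OF assms(1)]
  have "integral {a..b} (\<lambda>y. u y * v y) \<le> integral {a..b} (\<lambda>y. (u y * u y + v y * v y) / 2)"
  proof (rule integral_le)
    fix y
    show "u y * v y \<le> (u y * u y + v y * v y) / 2"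
      using sum_squares_bound[of "u y" "v y"] by (simp add: power2_eq_square)
  qed (auto intro!: integrable_add int assms)
  then show ?thesis
    by (simp add: integral_add[OF int[OF assms(2,2)] int[OF assms(3,3)]])
qed

text \<open>The energy inequality of one time step: the reaction term and the squared norm of
  \<open>p n\<close> are nonnegative and are dropped, and the common factor \<beta> is divided
  out.\<close>

lemma ldg_solution_step:
  fixes n M :: nat and T a b :: real and u :: "nat \<Rightarrow> real \<Rightarrow> real"
  defines "\<tau> \<equiv> T / real M" and "S \<equiv> \<lambda>n. integral {a..b} (\<lambda>y. u n y * u n y)"
  assumes "0 < \<alpha>" "\<alpha> < 1" "0 \<le> \<gamma>" "0 < \<rho>" "0 < T" "a < b" "0 < M"
    and mesh: "is_mesh a b N x"
    and sol: "ldg_solution bc \<alpha> \<gamma> \<rho> (\<lambda>_ _. 0) T M a b N x k \<delta> u p"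
    and n: "n \<in> {1..M}"
  shows "S n \<le> (\<Sum>i=1..n - 1. (time_weight \<alpha> (i - 1) - time_weight \<alpha> i)
                    * exp (- real i * \<gamma> * \<tau>) * integral {a..b} (\<lambda>y. u (n - i) y * u n y))
              + time_weight \<alpha> (n - 1) * exp (- real n * \<gamma> * \<tau>)
                    * integral {a..b} (\<lambda>y. u 0 y * u n y)" (is "_ \<le> ?R")
proof -
  define \<beta> where "\<beta> = \<tau> powr (- \<alpha>) / Gamma (2 - \<alpha>)"
  have "\<beta> > 0"
    unfolding \<beta>_def \<tau>_def using assms by (intro divide_pos_pos Gamma_real_pos) auto
  \<comment> \<open>Without cells, \<open>x 0\<close> would be both \<open>a\<close> and
    \<open>b\<close>.\<close>
  have "N > 0"
    using mesh \<open>a < b\<close> by (cases N) (auto simp: is_mesh_def)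
  have un: "u n \<in> dg_space k N x" and pn: "p n \<in> dg_space k N x"
    using sol n by (auto simp: ldg_solution_def Let_def)
  have "(\<rho> + \<beta>) * S n + integral {a..b} (\<lambda>y. p n y * deriv (u n) y)
      - flux_sum bc N x (weighted_average bc N x (1 - \<delta>) (p n)) (u n) = \<beta> * ?R"
    using sol n un unfolding ldg_solution_def Let_def \<beta>_def S_def \<tau>_def by simp
  moreover have "integral {a..b} (\<lambda>y. p n y * p n y) + integral {a..b} (\<lambda>y. u n y * deriv (p n) y)
      - flux_sum bc N x (weighted_average bc N x \<delta> (u n)) (p n) = 0"
    using sol n pn unfolding ldg_solution_def Let_def by blast
  moreover note flux_terms_cancel[OF mesh \<open>N > 0\<close> un pn, of bc \<delta>]
  ultimately have "(\<rho> + \<beta>) * S n + integral {a..b} (\<lambda>y. p n y * p n y) = \<beta> * ?R"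
    by linarith
  moreover have "0 \<le> integral {a..b} (\<lambda>y. p n y * p n y)"
    by (intro integral_nonneg integrable_dg_mult[OF mesh pn pn]) simp
  moreover have "0 \<le> S n"
    unfolding S_def by (intro integral_nonneg integrable_dg_mult[OF mesh un un]) simp
  then have "0 \<le> \<rho> * S n"
    using \<open>0 < \<rho>\<close> by simp
  ultimately have "\<beta> * S n \<le> \<beta> * ?R"
    by (simp add: distrib_right)
  then show ?thesis
    using \<open>\<beta> > 0\<close> by simp
qed

text \<open>The history term involves all earlier time levels, hence strong induction, carried out
  for the squared norms \<open>S\<close>.\<close>

lemma ldg_solution_norm_le:
  fixes n :: nat
  assumes "0 < \<alpha>" "\<alpha> < 1" "0 \<le> \<gamma>" "0 < \<rho>" "0 < T" "a < b" "0 < M"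
    and mesh: "is_mesh a b N x"
    and sol: "ldg_solution bc \<alpha> \<gamma> \<rho> (\<lambda>_ _. 0) T M a b N x k \<delta> u p"
    and "n \<le> M"
  shows "L2_norm a b (u n) \<le> L2_norm a b (u 0)"
proof -
  define S where "S n = integral {a..b} (\<lambda>y. u n y * u n y)" for n
  define \<tau> where "\<tau> = T / real M"
  let ?b = "time_weight \<alpha>"
  have "\<tau> > 0" using assms by (simp add: \<tau>_def)
  have space: "u i \<in> dg_space k N x" if "i \<le> M" for i
    using that sol by (cases "i = 0") (auto simp: ldg_solution_def Let_def)
  have S_nonneg: "0 \<le> S i" if "i \<le> M" for i
    unfolding S_def by (intro integral_nonneg integrable_dg_mult[OF mesh space space] that) simp
  have "S n \<le> S 0"
    using \<open>n \<le> M\<close>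
  proof (induction n rule: less_induct)
    case (less n)
    show ?case
    proof (cases "n = 0")
      case False
      then have n: "n \<in> {1..M}" using less.prems by auto
      \<comment> \<open>A common bound for the inner products of \<open>u n\<close> with all earlier
        levels: Young's inequality gives \<open>(S i + S n) / 2\<close>, and the induction
        hypothesis replaces \<open>S i\<close> by \<open>S 0\<close>.\<close>
      define K where "K = (S 0 + S n) / 2"
      have "K \<ge> 0" using S_nonneg less.prems by (simp add: K_def)
      \<comment> \<open>Covers the terms of the history sum and the initial term alike;
        \<open>l\<close> is the number of steps in the damping factor, \<open>i\<close> the time
        level.\<close>
      have term_le: "w * exp (- real l * \<gamma> * \<tau>) * integral {a..b} (\<lambda>y. u i y * u n y) \<le> w * K"
        if "i < n" "w \<ge> 0" for i l w
      proof -
        have "integral {a..b} (\<lambda>y. u i y * u n y) \<le> (S i + S n) / 2"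
          using integral_dg_mult_le[OF mesh space space] that less.prems by (simp add: S_def)
        also have "\<dots> \<le> K"
          using less.IH that less.prems by (simp add: K_def)
        finally have "exp (- real l * \<gamma> * \<tau>) * integral {a..b} (\<lambda>y. u i y * u n y)
            \<le> exp (- real l * \<gamma> * \<tau>) * K"
          by (rule mult_left_mono) simp
        \<comment> \<open>Tempering with \<gamma> \<ge> 0 only damps: the exponential is at most
          1.\<close>
        also have "\<dots> \<le> 1 * K"
          using \<open>\<tau> > 0\<close> \<open>0 \<le> \<gamma>\<close> \<open>K \<ge> 0\<close> by (intro mult_right_mono) auto
        finally show ?thesis
          using that by (simp add: mult.assoc mult_left_mono)
      qed
      have "S n \<le> (\<Sum>i=1..n - 1. (?b (i - 1) - ?b i) * exp (- real i * \<gamma> * \<tau>)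
              * integral {a..b} (\<lambda>y. u (n - i) y * u n y))
          + ?b (n - 1) * exp (- real n * \<gamma> * \<tau>) * integral {a..b} (\<lambda>y. u 0 y * u n y)"
        using ldg_solution_step[OF assms(1-9) n] by (simp add: S_def \<tau>_def)
      also have "\<dots> \<le> (\<Sum>i=1..n - 1. (?b (i - 1) - ?b i) * K) + ?b (n - 1) * K"
      proof (intro add_mono sum_mono term_le)
        fix i assume "i \<in> {1..n - 1}"
        then show "n - i < n" and "0 \<le> ?b (i - 1) - ?b i"
          using time_weight_antimono[OF assms(1,2), of "i - 1"] by auto
      qed (use False time_weight_nonneg assms in auto)
      \<comment> \<open>The differences of the weights telescope, and together with the last weight
        they sum to \<open>time_weight \<alpha> 0 = 1\<close>.\<close>
      also have "\<dots> = K"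
      proof -
        have "(\<Sum>i=1..n - 1. ?b (i - 1) - ?b i) = ?b 0 - ?b (n - 1)"
          using sum_diff_pred[of "\<lambda>i. - ?b i" "n - 1"] by simp
        then show ?thesis
          by (simp only: sum_distrib_right[symmetric] time_weight_0) (simp add: algebra_simps)
      qed
      \<comment> \<open>Half of \<open>S n\<close> is absorbed on the left of
        \<open>S n \<le> (S 0 + S n) / 2\<close>.\<close>
      finally show ?thesis by (simp add: K_def)
    qed simp
  qed
  then show ?thesis
    by (simp add: L2_norm_def S_def power2_eq_square)
qed

theorem theorem3p1:
  fixes \<alpha> \<gamma> \<rho> T a b \<kappa> \<delta> :: real and k :: nat and bc :: boundary_condition
  assumes "0 < \<alpha>" and "\<alpha> < 1" and "\<gamma> \<ge> 0" and "\<rho> > 0"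
    and "T > 0" and "a < b" and "\<kappa> > 0" and "\<delta> \<noteq> 1 / 2"
  shows "unconditionally_stable bc \<alpha> \<gamma> \<rho> T a b \<kappa> k \<delta> \<and>
    (\<forall>M N x u p.
       M > 0 \<longrightarrow> is_mesh a b N x \<longrightarrow> quasi_uniform \<kappa> N x \<longrightarrow>
       ldg_solution bc \<alpha> \<gamma> \<rho> (\<lambda>_ _. 0) T M a b N x k \<delta> u p \<longrightarrow>
       (\<forall>n\<in>{1..M}. L2_norm a b (u n) \<le> L2_norm a b (u 0)))"
proof -
  have stable: "L2_norm a b (u n) \<le> L2_norm a b (u 0)"
    if "M > 0" "is_mesh a b N x"
      "ldg_solution bc \<alpha> \<gamma> \<rho> (\<lambda>_ _. 0) T M a b N x k \<delta> u p" "n \<in> {1..M}" for M N x u p n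
    using ldg_solution_norm_le[OF assms(1-6) that(1-3)] that(4) by simp
  \<comment> \<open>The stability constant is 1, whatever the mesh and the time step.\<close>
  then show ?thesis
    unfolding unconditionally_stable_def by (intro conjI exI[of _ 1]) auto
qed

end
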